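(* Let $\Sigma$ be a finite non-empty alphabet, let $k\in\mathbb N$ with $k>1$, and let $w,w'\in\Sigma^*$ with $|w|\ge k$, $|w'|\ge k$ and $|w|_a<k$, $|w'|_a<k$ for all $a\in\Sigma$. Then $w\overset{J}{\sim}_{k,k-1}w'$ if and only if $p(w)=p(w')$.
   Context: $\mathbb N=\{1,2,\dots\}$, $\mathbb N_0=\mathbb N\cup\{0\}$. For a word $w\in\Sigma^*$, $|w|$ is its length, $|w|_a$ the number of occurrences of the letter $a$ in $w$, and $p(w)=(|w|_a)_{a\in\Sigma}$ its Parikh vector; $p(u)\le p(w)$ is meant componentwise. $\mathrm{ScatFact}(w)$ is the set of (not necessarily contiguous) subsequences of $w$. For $S\subseteq\Sigma^*$, $S_k=S\cap\Sigma^k$ and $S_{\le k}=\bigcup_{i=0}^k S_i$. For $\ell\in\mathbb N_0$, $\mathrm{JScatFact}(w,\ell)$ is the set of words $u\in\Sigma^*$ with $0\le\ell\le|u|-1$ (with only $\ell=0$ allowed if $u$ is empty), $p(u)\le p(w)$, and such that there is $v\in\mathrm{ScatFact}_{|u|-\ell}(u)$ with $v\in\mathrm{ScatFact}(w)$. For $v,w\in\Sigma^*$, $v\overset{J}{\sim}_{k,\ell}w$ means $\mathrm{JScatFact}_{\le k}(v,\ell)=\mathrm{JScatFact}_{\le k}(w,\ell)$. *)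

theory Defs
  imports Main "HOL-Library.Sublist"
begin

text \<open>The alphabet is the type \<open>'a\<close> and words are lists over it.  On the function type
  \<open>'a \<Rightarrow> nat\<close> the library order is the componentwise one.\<close>

definition parikh :: "'a list \<Rightarrow> 'a \<Rightarrow> nat"
  where "parikh w = (\<lambda>a. count_list w a)"

definition ScatFact :: "'a list \<Rightarrow> 'a list set"
  where "ScatFact w = {v. subseq v w}"

definition len_eq :: "'a list set \<Rightarrow> nat \<Rightarrow> 'a list set"
  where "len_eq S k = {u \<in> S. length u = k}"

definition len_le :: "'a list set \<Rightarrow> nat \<Rightarrow> 'a list set"
  where "len_le S k = (\<Union>i\<in>{0..k}. len_eq S i)"

text \<open>The bound \<open>l \<le> length u - 1\<close> is only used for non-empty \<open>u\<close>, so neither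
  subtraction below truncates.\<close>

definition JScatFact :: "'a list \<Rightarrow> nat \<Rightarrow> 'a list set"
  where "JScatFact w l =
    {u. (if u = [] then l = 0 else l \<le> length u - 1) \<and>
        parikh u \<le> parikh w \<and>
        (\<exists>v \<in> len_eq (ScatFact u) (length u - l). v \<in> ScatFact w)}"

definition J_equiv :: "nat \<Rightarrow> nat \<Rightarrow> 'a list \<Rightarrow> 'a list \<Rightarrow> bool"
  where "J_equiv k l v w \<longleftrightarrow> len_le (JScatFact v l) k = len_le (JScatFact w l) k"

end

theory Submission
  imports Defs
begin

text \<open>A non-empty word \<open>u\<close> with \<open>p(u) \<le> p(w)\<close> shares its first letter with \<open>w\<close>, so with
  \<open>k - 1\<close> jokers the subsequence condition holds for free and the \<open>J\<close>-factors of length at most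
  \<open>k\<close> are exactly the words of length \<open>k\<close> with \<open>p(u) \<le> p(w)\<close>. As \<open>|w|\<^sub>a < k \<le> |w|\<close>, one of
  them contains all occurrences of \<open>a\<close> in \<open>w\<close>, which recovers \<open>|w|\<^sub>a\<close> as a maximum over this set.\<close>

lemma len_le_JScatFact_pred:
  assumes "k > 1"
  shows "len_le (JScatFact w (k - 1)) k = {u. length u = k \<and> parikh u \<le> parikh w}"
proof -
  have "u \<in> JScatFact w (k - 1)" if u: "length u = k" "parikh u \<le> parikh w" for u
  proof -
    obtain x xs where x: "u = x # xs"
      using u(1) assms by (cases u) auto
    have "count_list w x > 0"
      using le_funD[OF u(2), of x] by (simp add: x parikh_def)
    then have "x \<in> set w"
      by (metis count_list_0_iff less_irrefl)
    \<comment> \<open>With \<open>k - 1\<close> jokers in a word of length \<open>k\<close>, a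
      single letter has to survive.\<close>
    then have "[x] \<in> ScatFact w" "[x] \<in> len_eq (ScatFact u) (length u - (k - 1))"
      using u(1) assms by (auto simp: ScatFact_def len_eq_def x subseq_singleton_left)
    then show ?thesis
      using u x by (auto simp: JScatFact_def)
  qed
  \<comment> \<open>The joker bound forces length at least \<open>k\<close> on non-empty words;
    \<open>[]\<close> drops out because \<open>k - 1\<close> is positive.\<close>
  moreover have "length u = k \<and> parikh u \<le> parikh w"
    if "u \<in> JScatFact w (k - 1)" "length u \<le> k" for u
    using that assms by (cases u) (auto simp: JScatFact_def)
  moreover have "len_le S k = {u \<in> S. length u \<le> k}" for S :: "'a list set"
    by (auto simp: len_le_def len_eq_def)
  ultimately show ?thesis by blast
qed

text \<open>Move all occurrences of \<open>a\<close> to the front of \<open>w\<close> and cut after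
  \<open>k\<close> letters: reordering keeps the Parikh vector, and a prefix can only lower
  it.\<close>

lemma exists_parikh_le_with_full_count:
  assumes "count_list w a \<le> k" "k \<le> length w"
  shows "\<exists>u. length u = k \<and> parikh u \<le> parikh w \<and> count_list u a = count_list w a"
proof -
  define xs where "xs = filter (\<lambda>x. x = a) w"
  define ys where "ys = filter (\<lambda>x. x \<noteq> a) w"
  define u where "u = take k (xs @ ys)"
  have len: "length xs = count_list w a" "length xs + length ys = length w"
    unfolding xs_def ys_def by (induction w) auto
  have cnt: "count_list (xs @ ys) b = count_list w b" for b
    unfolding xs_def ys_def by (induction w) auto
  have split: "count_list (xs @ ys) b = count_list u b + count_list (drop k (xs @ ys)) b" for b
    unfolding u_def by (metis append_take_drop_id count_list_append)
  \<comment> \<open>Since \<open>xs\<close> has at most \<open>k\<close> letters, the cut removes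
    letters of \<open>ys\<close> only.\<close>
  have "a \<notin> set (drop k (xs @ ys))"
    using assms(1) len(1) by (auto simp: ys_def dest: in_set_dropD)
  then have "count_list u a = count_list w a"
    using split[of a] cnt[of a] by simp
  moreover have "count_list u b \<le> count_list w b" for b
    using split[of b] cnt[of b] by simp
  then have "parikh u \<le> parikh w"
    by (simp add: parikh_def le_fun_def)
  moreover have "length u = k"
    using assms(2) len(2) by (simp add: u_def)
  ultimately show ?thesis by blast
qed

theorem proposition29:
  fixes w w' :: "'a::finite list" and k :: nat
  assumes "k > 1"
    and "length w \<ge> k" and "length w' \<ge> k"
    and "\<And>a. count_list w a < k" and "\<And>a. count_list w' a < k"
  shows "J_equiv k (k - 1) w w' \<longleftrightarrow> parikh w = parikh w'"
proof
  \<comment> \<open>Used in both directions; antisymmetry then gives equality.\<close>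
  have le: "parikh v \<le> parikh v'"
    if J: "J_equiv k (k - 1) v v'" and v: "k \<le> length v" "\<And>a. count_list v a < k" for v v' :: "'a list"
  proof (rule le_funI)
    fix a
    obtain u where u: "length u = k" "parikh u \<le> parikh v" "count_list u a = count_list v a"
      using exists_parikh_le_with_full_count v less_imp_le by metis
    then have "parikh u \<le> parikh v'"
      using J unfolding J_equiv_def len_le_JScatFact_pred[OF assms(1)] by blast
    then show "parikh v a \<le> parikh v' a"
      using u(3) le_funD[of "parikh u" "parikh v'" a] by (simp add: parikh_def)
  qed
  assume "J_equiv k (k - 1) w w'"
  then show "parikh w = parikh w'"
    using le[of w w'] le[of w' w] assms by (simp add: J_equiv_def order_antisym)
next
  assume "parikh w = parikh w'"
  then show "J_equiv k (k - 1) w w'"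
    unfolding J_equiv_def len_le_JScatFact_pred[OF assms(1)] by simp
qed

end
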